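(* Let $G=(V,E)$ be a (fully observed) polytree. The third-order moment polytope $P_G^{(3)}\subseteq\mathbb{R}^{|V|+|E|}$ is the set of solutions $(\mathbf{z},\mathbf{y})=((z_l)_{l\in V},(y_{lm})_{l\to m\in E})$ of the following equations and inequalities: $$z_l\ge 0\quad\text{for all } l\in V,$$ $$y_{lm}\ge 0\quad\text{for all } l\to m\in E,$$ $$\sum_{l\in V}z_l=1,$$ $$2z_l+\sum_{h\in \mathrm{pa}(l)}y_{hl}-y_{lm}\ge 0\quad\text{for all } l\to m\in E,$$ $$3z_l+\sum_{h\in \mathrm{pa}(l)}y_{hl}-\sum_{m\in \mathrm{ch}(l)}y_{lm}\ge 0\quad\text{for all } l\in V.$$
   Context: A polytree is a finite directed acyclic graph $G=(V,E)$ whose underlying undirected graph is a tree ("fully observed" means there are no hidden vertices). For $l\in V$, $\mathrm{pa}(l)=\{h: h\to l\in E\}$ and $\mathrm{ch}(l)=\{m: l\to m\in E\}$. A 3-trek between $i,j,k\in V$ (not necessarily distinct) is an ordered triple of directed paths (possibly empty, i.e. a single vertex) with sinks $i,j,k$ respectively and a common source, called its top. It is simple (minimal) if its top is the only vertex lying on all three paths. In a polytree, if a 3-trek between $i,j,k$ exists, there is a unique simple one; $\operatorname{top}(i,j,k)$ denotes its top. For $i,j,k\in V$ such that a 3-trek between them exists, $e_{ijk}=(\mathbf{z},\mathbf{y})\in\mathbb{R}^{|V|+|E|}$ is the vector with $\mathbf{z}=(z_l)_{l\in V}$, $z_l=1$ if $l=\operatorname{top}(i,j,k)$ and $z_l=0$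 otherwise, and $\mathbf{y}=(y_{lm})_{l\to m\in E}$, where $y_{lm}$ is the number of times the edge $l\to m$ occurs in the three paths of the simple 3-trek between $i,j,k$ (counted with multiplicity). The third-order moment polytope of $G$ is $$P_G^{(3)}=\mathrm{conv}\{e_{ijk}: i,j,k\in V\text{ such that a 3-trek between } i,j,k\text{ exists}\}.$$ *)

theory Defs
  imports "HOL-Analysis.Analysis" "Graph_Theory.Graph_Theory"
begin

text \<open>
  The library predicate \<open>tree\<close> is not the one needed here: \<open>tree G\<close> only excludes directed cycles of
  \<open>G\<close>, and \<open>tree (mk_symmetric G)\<close> fails as soon as there is an edge, because \<open>u, v, u\<close> is then a
  cycle of the bidirected graph. An undirected cycle is therefore a cycle of \<open>mk_symmetric G\<close> of
  length at least 3.
\<close>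

definition underlying_tree :: "'v pair_pre_digraph \<Rightarrow> bool" where
  "underlying_tree G \<longleftrightarrow>
     Digraph_Component.connected G \<and> \<not> (\<exists>p. pre_digraph.cycle (mk_symmetric G) p \<and> length p \<ge> 3)"

definition polytree :: "'v pair_pre_digraph \<Rightarrow> bool" where
  "polytree G \<longleftrightarrow>
     fin_digraph G \<and> \<not> (\<exists>p. pre_digraph.cycle G p) \<and> underlying_tree G"

definition pa :: "'v pair_pre_digraph \<Rightarrow> 'v \<Rightarrow> 'v set" where
  "pa G l = {h. (h, l) \<in> parcs G}"

definition ch :: "'v pair_pre_digraph \<Rightarrow> 'v \<Rightarrow> 'v set" where
  "ch G l = {m. (l, m) \<in> parcs G}"

text \<open>
  A 3-trek is stored as its top \<open>t\<close> followed by its three paths, each a list of edges. The top has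
  to be kept since all three lists may be empty.
\<close>

type_synonym 'v trek3 = "'v \<times> ('v \<times> 'v) list \<times> ('v \<times> 'v) list \<times> ('v \<times> 'v) list"

fun is_trek3 :: "'v pair_pre_digraph \<Rightarrow> 'v \<Rightarrow> 'v \<Rightarrow> 'v \<Rightarrow> 'v trek3 \<Rightarrow> bool" where
  "is_trek3 G i j k (t, p, q, r) \<longleftrightarrow>
     pre_digraph.apath G t p i \<and> pre_digraph.apath G t q j \<and> pre_digraph.apath G t r k"

fun is_simple_trek3 :: "'v pair_pre_digraph \<Rightarrow> 'v \<Rightarrow> 'v \<Rightarrow> 'v \<Rightarrow> 'v trek3 \<Rightarrow> bool" where
  "is_simple_trek3 G i j k (t, p, q, r) \<longleftrightarrow>
     is_trek3 G i j k (t, p, q, r) \<and>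
     set (pre_digraph.awalk_verts G t p) \<inter> set (pre_digraph.awalk_verts G t q) \<inter>
       set (pre_digraph.awalk_verts G t r) = {t}"

text \<open>
  Only meaningful if a 3-trek between \<open>i\<close>, \<open>j\<close>, \<open>k\<close> exists; in a polytree the simple one is then unique.
\<close>

definition simple_trek3 :: "'v pair_pre_digraph \<Rightarrow> 'v \<Rightarrow> 'v \<Rightarrow> 'v \<Rightarrow> 'v trek3" where
  "simple_trek3 G i j k = (THE T. is_simple_trek3 G i j k T)"

text \<open>
  The space indexed by the vertices and edges of \<open>G\<close> is realised as the coordinate subspace of
  \<open>(real ^ 'v) \<times> (real ^ ('v \<times> 'v))\<close> in which all coordinates not belonging to a vertex
  or an edge of \<open>G\<close> vanish; coordinate \<open>(l, m)\<close> of the second component is \<open>y\<^sub>l\<^sub>m\<close>.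
\<close>

definition moment_space :: "'v::finite pair_pre_digraph \<Rightarrow> ((real ^ 'v) \<times> (real ^ ('v \<times> 'v))) set" where
  "moment_space G =
     {(z, y). (\<forall>l. l \<notin> pverts G \<longrightarrow> z $ l = 0) \<and> (\<forall>a. a \<notin> parcs G \<longrightarrow> y $ a = 0)}"

fun trek3_vec :: "'v::finite trek3 \<Rightarrow> (real ^ 'v) \<times> (real ^ ('v \<times> 'v))" where
  "trek3_vec (t, p, q, r) =
     (\<chi> l. if l = t then 1 else 0,
      \<chi> a. real (count_list p a + count_list q a + count_list r a))"

definition e3 :: "'v::finite pair_pre_digraph \<Rightarrow> 'v \<Rightarrow> 'v \<Rightarrow> 'v \<Rightarrow> (real ^ 'v) \<times> (real ^ ('v \<times> 'v))" where
  "e3 G i j k = trek3_vec (simple_trek3 G i j k)"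

definition moment_polytope3 ::
    "'v::finite pair_pre_digraph \<Rightarrow> ((real ^ 'v) \<times> (real ^ ('v \<times> 'v))) set" where
  "moment_polytope3 G = convex hull
     {e3 G i j k | i j k.
        i \<in> pverts G \<and> j \<in> pverts G \<and> k \<in> pverts G \<and> (\<exists>T. is_trek3 G i j k T)}"

end

theory Submission
  imports Defs
begin

text \<open>
  Removing an edge \<open>e\<close> of a polytree splits the vertices into two sides, and a directed walk uses
  \<open>e\<close> exactly once if it starts on the tail side and ends on the head side, and never otherwise.
  Hence directed paths are determined by their ends. If two simple 3-treks between \<open>i, j, k\<close> had
  tops separated by \<open>e\<close>, all three paths of one of them would use \<open>e\<close>; so the simple 3-trek is
  unique.

  The vectors \<open>e\<^sub>i\<^sub>j\<^sub>k\<close> satisfy the inequalities by counting how often the paths enter and leave a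
  vertex. For the converse, drop the normalisation and let \<open>(z, y) \<noteq> 0\<close> be a point of the
  resulting cone. Some \<open>z\<^sub>t\<close> is positive, and starting at \<open>t\<close> one can greedily build a simple
  3-trek \<open>T\<close> of the form \<open>(t, p, p, q)\<close> on whose vector every inequality that is tight at
  \<open>(z, y)\<close> is tight as well. Subtracting the largest admissible multiple of this vector keeps the
  point in the cone and makes one more inequality tight, so after finitely many steps \<open>(z, y)\<close> is
  written as a conic combination of such vectors, which is convex when the \<open>z\<^sub>l\<close> sum to 1.
\<close>

section \<open>Arc counts of walks\<close>

lemma of_bool_count_distinct: "distinct xs \<Longrightarrow> count_list xs a = of_bool (a \<in> set xs)"
  by (induction xs) auto

lemma sum_count_list_snd:
  assumes "finite A" "\<And>h. h \<in> A \<longleftrightarrow> (h, l) \<in> R" "set p \<subseteq> R"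
  shows "(\<Sum>h\<in>A. count_list p (h, l)) = count_list (map snd p) l"
  using assms(3)
proof (induction p)
  case (Cons e p)
  have "(\<Sum>h\<in>A. count_list (e # p) (h, l)) =
      (\<Sum>h\<in>A. if h = fst e then of_bool (snd e = l) else 0) + (\<Sum>h\<in>A. count_list p (h, l))"
    unfolding sum.distrib[symmetric] by (rule sum.cong) (auto simp: prod_eq_iff)
  then show ?case
    using Cons assms(1,2) by (cases e) (auto simp: sum.delta)
qed simp

lemma sum_count_list_fst:
  assumes "finite A" "\<And>m. m \<in> A \<longleftrightarrow> (l, m) \<in> R" "set p \<subseteq> R"
  shows "(\<Sum>m\<in>A. count_list p (l, m)) = count_list (map fst p) l"
  using assms(3)
proof (induction p)
  case (Cons e p)
  have "(\<Sum>m\<in>A. count_list (e # p) (l, m)) =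
      (\<Sum>m\<in>A. if m = snd e then of_bool (fst e = l) else 0) + (\<Sum>m\<in>A. count_list p (l, m))"
    unfolding sum.distrib[symmetric] by (rule sum.cong) (auto simp: prod_eq_iff)
  then show ?case
    using Cons assms(1,2) by (cases e) (auto simp: sum.delta)
qed simp

lemma count_list_pair_le_fst: "count_list p (a, b) \<le> count_list (map fst p) a"
  by (induction p) auto

text \<open>Every visit is either the start or the entry through an edge. The companion lemma counts
  exits instead, and comparing the two gives conservation of flow along a walk.\<close>

lemma count_list_pawalk_verts_snd:
  assumes "pcas u p v"
  shows "count_list (pawalk_verts u p) l = of_bool (l = u) + count_list (map snd p) l"
  using assms by (induction p arbitrary: u) auto

lemma count_list_pawalk_verts_fst:
  assumes "pcas u p v"
  shows "count_list (pawalk_verts u p) l = count_list (map fst p) l + of_bool (l = v)"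
  using assms by (induction p arbitrary: u) auto

lemma set_pawalk_verts_fst: "pcas u p v \<Longrightarrow> set (pawalk_verts u p) = insert v (fst ` set p)"
  by (induction p arbitrary: u) auto

lemma set_pawalk_verts_snd: "pcas u p v \<Longrightarrow> set (pawalk_verts u p) = insert u (snd ` set p)"
  by (induction p arbitrary: u) auto

lemma fst_in_pawalk_verts: "(a, b) \<in> set p \<Longrightarrow> a \<in> set (pawalk_verts u p)"
  by (induction p arbitrary: u) auto

lemma snd_in_pawalk_verts: "pcas u p v \<Longrightarrow> (a, b) \<in> set p \<Longrightarrow> b \<in> set (pawalk_verts u p)"
  by (force simp: set_pawalk_verts_snd)

section \<open>Edge cuts of a polytree\<close>

text \<open>
  The role of \<open>side e\<close> is that of the component containing the head of \<open>e\<close> after removing the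
  edge \<open>e\<close> from the underlying tree.
\<close>

locale edge_cuts = pair_fin_digraph G for G :: "'v pair_pre_digraph" +
  fixes side :: "'v \<times> 'v \<Rightarrow> 'v set"
  assumes fst_notin_side: "e \<in> parcs G \<Longrightarrow> fst e \<notin> side e"
    and snd_in_side: "e \<in> parcs G \<Longrightarrow> snd e \<in> side e"
    and side_iff: "e \<in> parcs G \<Longrightarrow> a \<in> parcs G \<Longrightarrow> a \<noteq> e \<Longrightarrow> fst a \<in> side e \<longleftrightarrow> snd a \<in> side e"
    and separated: "u \<in> pverts G \<Longrightarrow> v \<in> pverts G \<Longrightarrow> u \<noteq> v \<Longrightarrow>
      \<exists>e\<in>parcs G. (u \<in> side e) \<noteq> (v \<in> side e)"
begin

section \<open>Directed walks and the cuts they cross\<close>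

text \<open>By \<open>side_iff\<close> the indicator of \<open>side e\<close> can change only along
  \<open>e\<close> itself, where it rises from 0 to 1; the equation telescopes these
  changes.\<close>

lemma awalk_count_list:
  assumes "awalk u p v" "e \<in> parcs G"
  shows "of_bool (v \<in> side e) = of_bool (u \<in> side e) + count_list p e"
  using assms(1)
proof (induction p arbitrary: u)
  case (Cons a p)
  have a: "a \<in> parcs G" "u = fst a" and p: "awalk (snd a) p v"
    using Cons.prems by (auto simp: awalk_Cons_iff)
  show ?case
  proof (cases "a = e")
    case True
    then show ?thesis
      using Cons.IH[OF p] a fst_notin_side[OF assms(2)] snd_in_side[OF assms(2)] by simp
  next
    case False
    then show ?thesis
      using Cons.IH[OF p] a side_iff[OF assms(2) a(1)] by simp
  qed
qed (simp add: awalk_Nil_iff)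

text \<open>Equal ends force the count of every edge to be 0, so there is no first edge.\<close>

lemma awalk_closed_Nil:
  assumes "awalk u p u"
  shows "p = []"
proof (cases p)
  case (Cons e p')
  then have "e \<in> parcs G" using assms by (auto simp: awalk_Cons_iff)
  then show ?thesis using awalk_count_list[OF assms, of e] Cons by simp
qed

lemma awalk_imp_apath:
  assumes "awalk u p v"
  shows "apath u p v"
proof -
  have "distinct (pawalk_verts u p)"
  proof (rule ccontr)
    assume "\<not> ?thesis"
    then obtain q r s w where "p = q @ r @ s" "r \<noteq> []" "awalk w r w"
      using awalk_not_distinct_decomp[OF assms] by auto
    then show False using awalk_closed_Nil by blast
  qed
  then show ?thesis using assms by (simp add: apath_def)
qed

lemma awalk_unique:
  assumes "awalk u p v" "awalk u q v"
  shows "p = q"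
  using assms
proof (induction p arbitrary: u q)
  case Nil
  then show ?case using awalk_closed_Nil by (auto simp: awalk_Nil_iff)
next
  case (Cons e p)
  have e: "e \<in> parcs G" "fst e = u" "awalk (snd e) p v"
    using Cons.prems by (auto simp: awalk_Cons_iff)
  have "count_list q e = count_list (e # p) e"
    using awalk_count_list[OF Cons.prems(1) e(1)] awalk_count_list[OF Cons.prems(2) e(1)] by simp
  then have "e \<in> set q" by (cases "e \<in> set q") auto
  then obtain f q' where q: "q = f # q'" by (cases q) auto
  \<comment> \<open>The edge \<open>e\<close> leaves \<open>u\<close>, and \<open>q\<close> never
    returns to \<open>u\<close>; so \<open>e\<close> can only be the first edge of
    \<open>q\<close>.\<close>
  have "u \<notin> set (pawalk_verts (snd f) q')"
    using awalk_imp_apath[OF Cons.prems(2)] unfolding q by (auto simp: apath_Cons_iff)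
  then have "e \<notin> set q'"
    using e(2) fst_in_pawalk_verts[of u "snd e"] by (metis prod.collapse)
  then have "f = e" using \<open>e \<in> set q\<close> q by auto
  then show ?case using Cons.IH[OF e(3)] Cons.prems(2) q by (auto simp: awalk_Cons_iff)
qed

lemma awalk_side_mono:
  assumes "awalk u p v" "e \<in> parcs G" "u \<in> side e"
  shows "v \<in> side e"
  using awalk_count_list[OF assms(1,2)] assms(3) by (cases "v \<in> side e") auto

lemma in_set_awalk:
  assumes "awalk u p v" "e \<in> parcs G" "u \<notin> side e" "v \<in> side e"
  shows "e \<in> set p"
proof (rule ccontr)
  assume "e \<notin> set p"
  then show False using awalk_count_list[OF assms(1,2)] assms(3,4) by auto
qed

text \<open>A topological numbering: along an edge no cut is crossed backwards and the cut of the
  edge itself is gained. It serves as induction measure.\<close>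

definition height :: "'v \<Rightarrow> nat" where
  "height v = card {e \<in> parcs G. v \<in> side e}"

lemma height_less:
  assumes "(u, v) \<in> parcs G"
  shows "height u < height v"
proof -
  have "w \<in> {e \<in> parcs G. v \<in> side e}" if "w \<in> {e \<in> parcs G. u \<in> side e}" for w
    using that side_iff[of w "(u, v)"] snd_in_side[of "(u, v)"] assms by (cases "w = (u, v)") auto
  moreover have "(u, v) \<in> {e \<in> parcs G. v \<in> side e} - {e \<in> parcs G. u \<in> side e}"
    using fst_notin_side[OF assms] snd_in_side[OF assms] assms by simp
  ultimately show ?thesis
    unfolding height_def by (intro psubset_card_mono) (auto simp: pair_finite_arcs)
qed

text \<open>Heights increase along the chosen edges and are bounded, so following \<open>nx\<close>
  must stop.\<close>

lemma follow_successors: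
  assumes "\<And>a b. nx a = Some b \<Longrightarrow> (a, b) \<in> parcs G" "u \<in> pverts G"
  obtains p v where "awalk u p v" "\<And>a b. (a, b) \<in> set p \<Longrightarrow> nx a = Some b" "nx v = None"
proof -
  have "\<exists>p v. awalk u p v \<and> (\<forall>(a, b)\<in>set p. nx a = Some b) \<and> nx v = None"
    using assms(2)
  proof (induction "Max (height ` pverts G) - height u" arbitrary: u rule: less_induct)
    case less
    show ?case
    proof (cases "nx u")
      case None
      then show ?thesis
        using less.prems by (intro exI[of _ "[]"] exI[of _ u]) (auto simp: awalk_Nil_iff)
    next
      case (Some w)
      then have uw: "(u, w) \<in> parcs G" using assms(1) by auto
      then have w: "w \<in> pverts G" using in_arcsD2 by auto
      have "height w \<le> Max (height ` pverts G)" using w pair_finite_verts by auto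
      then have "Max (height ` pverts G) - height w < Max (height ` pverts G) - height u"
        using height_less[OF uw] by linarith
      then obtain p v where "awalk w p v" "\<forall>(a, b)\<in>set p. nx a = Some b" "nx v = None"
        using less.hyps w by blast
      then show ?thesis
        using Some uw by (intro exI[of _ "(u, w) # p"] exI[of _ v]) (auto simp: awalk_Cons_iff)
    qed
  qed
  then obtain p v where "awalk u p v" "\<forall>(a, b)\<in>set p. nx a = Some b" "nx v = None"
    by blast
  then show ?thesis using that[of p v] by auto
qed

section \<open>Existence and uniqueness of simple 3-treks\<close>

lemma simple_trek3_unique_top:
  assumes "is_simple_trek3 G i j k (t, p, q, r)" "is_simple_trek3 G i j k (t', p', q', r')"
  shows "t = t'"
proof (rule ccontr)
  assume "t \<noteq> t'"
  \<comment> \<open>Stated for arbitrary treks, because either of the two tops may be the one on the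
    head side of the separating edge.\<close>
  have *: False if T: "is_simple_trek3 G i j k (t, p, q, r)"
    and T': "is_simple_trek3 G i j k (t', p', q', r')"
    and e: "e \<in> parcs G" "t \<notin> side e" "t' \<in> side e" for t p q r t' p' q' r' e
  proof -
    have w: "awalk t p i" "awalk t q j" "awalk t r k"
      and w': "awalk t' p' i" "awalk t' q' j" "awalk t' r' k"
      using T T' by (simp_all add: apath_def)
    have "e \<in> set p" "e \<in> set q" "e \<in> set r"
      using in_set_awalk[OF w(1) e(1,2)] in_set_awalk[OF w(2) e(1,2)] in_set_awalk[OF w(3) e(1,2)]
        awalk_side_mono[OF w'(1) e(1,3)] awalk_side_mono[OF w'(2) e(1,3)]
        awalk_side_mono[OF w'(3) e(1,3)]
      by blast+
    then have "{fst e, snd e} \<subseteq> set (pawalk_verts t p) \<inter> set (pawalk_verts t q) \<inter> set (pawalk_verts t r)"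
      using w unfolding awalk_def
      by (auto intro: snd_in_pawalk_verts[of _ _ _ "fst e"] fst_in_pawalk_verts[of _ "snd e"])
    then have "fst e = t" "snd e = t"
      using T by auto
    then show False using fst_notin_side[OF e(1)] snd_in_side[OF e(1)] by auto
  qed
  have "t \<in> pverts G" "t' \<in> pverts G"
    using assms by (auto simp: apath_def)
  then obtain e where "e \<in> parcs G" "(t \<in> side e) \<noteq> (t' \<in> side e)"
    using separated \<open>t \<noteq> t'\<close> by blast
  then show False using *[OF assms] *[OF assms(2,1)] by blast
qed

text \<open>Once the tops agree, \<open>awalk_unique\<close> fixes the three paths.\<close>

lemma simple_trek3_eq:
  assumes "is_simple_trek3 G i j k T"
  shows "simple_trek3 G i j k = T"
proof -
  obtain t p q r where T: "T = (t, p, q, r)" by (cases T rule: prod_cases4)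
  have "T' = T" if T': "is_simple_trek3 G i j k T'" for T'
  proof -
    obtain t' p' q' r' where T'_eq: "T' = (t', p', q', r')" by (cases T' rule: prod_cases4)
    have "t' = t" using simple_trek3_unique_top assms T' unfolding T T'_eq by blast
    then show ?thesis
      using assms T' unfolding T T'_eq by (auto simp: apath_def intro: awalk_unique)
  qed
  then show ?thesis unfolding simple_trek3_def using assms by (blast intro: the_equality)
qed

lemma awalk_suffix:
  assumes "awalk u p v" "w \<in> set (pawalk_verts u p)"
  obtains q where "awalk w q v" "w \<noteq> u \<Longrightarrow> length q < length p"
proof -
  obtain q r where "p = q @ r" "awalk u q w" "awalk w r v"
    using awalk_decomp[OF assms] by blast
  then show ?thesis using that[of r] by (cases q) (auto simp: awalk_Nil_iff)
qed

text \<open>A 3-trek of minimal total length is simple.\<close>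

lemma simple_trek3_exists:
  assumes "is_trek3 G i j k T"
  obtains T' where "is_simple_trek3 G i j k T'"
proof -
  define len :: "'v trek3 \<Rightarrow> nat" where
    "len = (\<lambda>(t, p, q, r). length p + length q + length r)"
  obtain T' where T': "is_trek3 G i j k T'" "\<And>T''. is_trek3 G i j k T'' \<Longrightarrow> len T' \<le> len T''"
    using ex_has_least_nat[of "is_trek3 G i j k" T len] assms by auto
  obtain t p q r where T'_eq: "T' = (t, p, q, r)" by (cases T' rule: prod_cases4)
  have w: "awalk t p i" "awalk t q j" "awalk t r k"
    using T'(1) by (auto simp: T'_eq apath_def)
  have "x = t" if x: "x \<in> set (pawalk_verts t p)" "x \<in> set (pawalk_verts t q)"
    "x \<in> set (pawalk_verts t r)" for x
  proof (rule ccontr)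
    assume "x \<noteq> t"
    \<comment> \<open>The suffixes starting at \<open>x\<close> form a shorter 3-trek with top
      \<open>x\<close>.\<close>
    obtain p' where p': "awalk x p' i" "length p' < length p"
      using awalk_suffix[OF w(1) x(1)] \<open>x \<noteq> t\<close> by metis
    obtain q' where q': "awalk x q' j" "length q' < length q"
      using awalk_suffix[OF w(2) x(2)] \<open>x \<noteq> t\<close> by metis
    obtain r' where r': "awalk x r' k" "length r' < length r"
      using awalk_suffix[OF w(3) x(3)] \<open>x \<noteq> t\<close> by metis
    have "is_trek3 G i j k (x, p', q', r')"
      using p' q' r' by (simp add: awalk_imp_apath)
    then show False
      using T'(2)[of "(x, p', q', r')"] p' q' r' by (simp add: len_def T'_eq)
  qed
  moreover have "t \<in> set (pawalk_verts t p)" "t \<in> set (pawalk_verts t q)" "t \<in> set (pawalk_verts t r)"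
    using w by (auto dest: hd_in_awalk_verts)
  ultimately have "is_simple_trek3 G i j k T'"
    using T'(1) by (auto simp: T'_eq)
  then show ?thesis using that by blast
qed

end

section \<open>Cuts obtained by removing an edge of a polytree\<close>

text \<open>Both orientations are deleted, since \<open>mk_symmetric G\<close> also contains the
  reversed edge.\<close>

definition edge_side :: "'v pair_pre_digraph \<Rightarrow> 'v \<times> 'v \<Rightarrow> 'v set" where
  "edge_side G e = {w. (snd e, w) \<in> (parcs (mk_symmetric G) - {e, prod.swap e})\<^sup>*}"

text \<open>The lack of undirected cycles keeps the tail of \<open>e\<close> out of
  \<open>edge_side G e\<close>, connectedness lets cuts separate vertices, and the lack of directed
  cycles excludes loops and antiparallel edges.\<close>

lemma polytree_edge_cuts:
  assumes "polytree G"
  shows "edge_cuts G (edge_side G)"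
proof -
  have fin: "fin_digraph (with_proj G)" using assms by (simp add: polytree_def)
  interpret pair_fin_digraph G
    using fin_digraph.finite_verts[OF fin] fin_digraph.finite_arcs[OF fin] fin_digraph.axioms(1)[OF fin]
    by (simp add: pair_fin_digraph_def pair_fin_digraph_axioms_def wf_digraph_wp_iff)
  interpret H: pair_fin_digraph "mk_symmetric G"
    by (rule fin_digraph.pair_fin_digraph_mk_symmetric[OF fin])
  have parcs_H: "parcs (mk_symmetric G) = parcs G \<union> (parcs G)\<inverse>"
    by (auto simp: parcs_mk_symmetric)
  define R where "R e = parcs (mk_symmetric G) - {e, prod.swap e}" for e
  have sym_R: "sym (R e)" for e
    unfolding R_def parcs_H by (cases e) (auto simp: sym_def)
  have no_cycle: "\<not> pre_digraph.cycle G p" for p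
    using assms by (simp add: polytree_def)
  have no_H_cycle: "\<not> pre_digraph.cycle (mk_symmetric G) p" if "length p \<ge> 3" for p
    using assms that by (auto simp: polytree_def underlying_tree_def)
  have loop: "fst e \<noteq> snd e" if "e \<in> parcs G" for e
  proof
    assume "fst e = snd e"
    then have "pre_digraph.cycle G [e]"
      using that unfolding pre_digraph.cycle_def by (auto simp: awalk_simps wellformed intro!: exI[of _ "fst e"])
    then show False using no_cycle by blast
  qed
  \<comment> \<open>A path from the head of \<open>e\<close> back to its tail in the remaining graph
    closes up with \<open>e\<close> to a cycle. It has length at least 3, since \<open>e\<close> is
    no loop and the reversed edge was removed.\<close>
  have notin: "fst e \<notin> edge_side G e" if e: "e \<in> parcs G" for e
  proof
    assume "fst e \<in> edge_side G e"
    then have *: "(snd e, fst e) \<in> (R e)\<^sup>*" by (simp add: edge_side_def R_def)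
    define K where "K = \<lparr>pverts = pverts G, parcs = R e\<rparr>"
    have K_simps: "pverts K = pverts G" "parcs K = R e" by (simp_all add: K_def)
    interpret K: pair_wf_digraph K
      by unfold_locales (auto simp: K_simps R_def parcs_H dest: wellformed')
    have "\<exists>p. K.awalk (snd e) p (fst e)"
      using *
    proof (induction rule: converse_rtrancl_induct)
      case base
      then show ?case
        using arc_fst_in_verts[OF e] by (intro exI[of _ "[]"]) (auto simp: K.awalk_Nil_iff K_simps)
    next
      case (step x w)
      then obtain p where "K.awalk w p (fst e)" by blast
      then have "K.awalk x ((x, w) # p) (fst e)"
        using step(1) by (auto simp: K.awalk_Cons_iff K_simps)
      then show ?case by blast
    qed
    then obtain p where p: "K.apath (snd e) p (fst e)" using K.apath_awalk_to_apath by blast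
    have set_p: "set p \<subseteq> R e" using p by (simp add: K.apath_def K.awalk_def K_simps)
    have "p \<noteq> []" using p loop[OF e] by (auto simp: K.apath_Nil_iff)
    moreover have "p \<noteq> [a]" for a
    proof
      assume "p = [a]"
      then have "a = prod.swap e" using p by (auto simp: K.apath_simps prod_eq_iff)
      then show False using set_p \<open>p = [a]\<close> by (auto simp: R_def)
    qed
    ultimately have "length (e # p) \<ge> 3"
      by (cases p; cases "tl p") auto
    moreover have "pre_digraph.cycle (mk_symmetric G) (e # p)"
    proof -
      have "H.awalk (snd e) p (fst e)"
        using p set_p arc_snd_in_verts[OF e]
        by (auto simp: K.apath_def K.awalk_def H.awalk_def R_def K_simps)
      then have "H.awalk (fst e) (e # p) (fst e)"
        using e by (auto simp: H.awalk_Cons_iff parcs_H)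
      moreover have "distinct (pawalk_verts (snd e) p)"
        using p by (simp add: K.apath_def)
      ultimately show ?thesis
        unfolding pre_digraph.cycle_def by (auto simp: awalk_verts_with_proj_eq)
    qed
    ultimately show False using no_H_cycle by blast
  qed
  have sep: "\<exists>e\<in>parcs G. (u \<in> edge_side G e) \<noteq> (v \<in> edge_side G e)"
    if uv: "u \<in> pverts G" "v \<in> pverts G" "u \<noteq> v" for u v
  proof -
    have "u \<rightarrow>\<^sup>*\<^bsub>mk_symmetric G\<^esub> v"
      using assms uv by (auto simp: polytree_def underlying_tree_def Digraph_Component.connected_def)
    then obtain p where p: "H.apath u p v" using H.reachable_apath by auto
    then obtain a p' where p_eq: "p = a # p'" using uv by (cases p) (auto simp: H.apath_Nil_iff)
    define w where "w = snd a"
    have a: "a = (u, w)" "(u, w) \<in> parcs (mk_symmetric G)" "H.awalk w p' v"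
      "u \<notin> set (pawalk_verts w p')"
      using p unfolding p_eq by (auto simp: H.awalk_Cons_iff w_def H.apath_def)
    \<comment> \<open>The rest of the path avoids \<open>u\<close>, hence uses neither orientation
      of the first edge.\<close>
    have wv: "(w, v) \<in> (R e)\<^sup>*" if "e = (u, w) \<or> e = (w, u)" for e
      using a(3,4)
    proof (induction p' arbitrary: w)
      case (Cons b q)
      have "fst b \<noteq> u" "snd b \<noteq> u"
        using Cons.prems by (auto dest: H.hd_in_awalk_verts simp: H.awalk_Cons_iff)
      then have "b \<in> R e"
        using Cons.prems that by (auto simp: R_def H.awalk_Cons_iff)
      moreover have "(snd b, v) \<in> (R e)\<^sup>*"
        using Cons.prems by (intro Cons.IH) (auto simp: H.awalk_Cons_iff)
      ultimately show ?case
        using Cons.prems by (cases b) (auto simp: H.awalk_Cons_iff intro: converse_rtrancl_into_rtrancl)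
    qed (simp add: H.awalk_Nil_iff)
    \<comment> \<open>The first edge of the undirected path separates \<open>u\<close> from
      \<open>v\<close>; the cases tell whether the path traverses it forwards or backwards.\<close>
    show ?thesis
    proof (cases "(u, w) \<in> parcs G")
      case True
      then show ?thesis
        using notin[OF True] wv[of "(u, w)"]
        by (intro bexI[of _ "(u, w)"]) (auto simp: edge_side_def R_def)
    next
      case False
      then have wu: "(w, u) \<in> parcs G" using a(2) by (auto simp: parcs_H)
      have "(u, v) \<notin> (R (w, u))\<^sup>*"
      proof
        assume "(u, v) \<in> (R (w, u))\<^sup>*"
        moreover have "(v, w) \<in> (R (w, u))\<^sup>*"
          using wv[of "(w, u)"] sym_rtrancl[OF sym_R] by (auto dest: symD)
        ultimately have "(u, w) \<in> (R (w, u))\<^sup>*" by (rule rtrancl_trans)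
        then show False using notin[OF wu] by (simp add: edge_side_def R_def)
      qed
      then show ?thesis
        using wu by (intro bexI[of _ "(w, u)"]) (auto simp: edge_side_def R_def)
    qed
  qed
  have iff: "fst a \<in> edge_side G e \<longleftrightarrow> snd a \<in> edge_side G e"
    if ea: "e \<in> parcs G" "a \<in> parcs G" "a \<noteq> e" for e a
  proof -
    have "a \<noteq> prod.swap e"
    proof
      assume "a = prod.swap e"
      then have "pre_digraph.cycle G [e, a]"
        using ea loop[OF ea(1)] arc_fst_in_verts[OF ea(1)] unfolding pre_digraph.cycle_def
        by (auto simp: awalk_simps intro!: exI[of _ "fst e"])
      then show False using no_cycle by blast
    qed
    then have "(fst a, snd a) \<in> R e" using ea by (auto simp: R_def parcs_H)
    moreover from this have "(snd a, fst a) \<in> R e" by (rule symD[OF sym_R])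
    ultimately show ?thesis
      unfolding edge_side_def R_def[symmetric] by (auto intro: rtrancl_into_rtrancl)
  qed
  show ?thesis
    by unfold_locales (use notin sep iff in \<open>auto simp: edge_side_def\<close>)
qed

section \<open>Descent in a polyhedral cone\<close>

text \<open>
  Moving from \<open>x\<close> in the direction \<open>- s\<close> until a further constraint becomes tight reduces
  the number of slack constraints.
\<close>

lemma polyhedral_cone_descent:
  fixes F :: "('a::real_vector \<Rightarrow> real) set" and w :: "'a \<Rightarrow> real"
  assumes F: "finite F" "\<And>f. f \<in> F \<Longrightarrow> linear f" and w: "linear w"
    and M: "subspace M" "S \<subseteq> M" and S: "\<And>s. s \<in> S \<Longrightarrow> w s = 1"
    and descent: "\<And>x. x \<in> M \<Longrightarrow> \<forall>f\<in>F. 0 \<le> f x \<Longrightarrow> x \<noteq> 0 \<Longrightarrow>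
      \<exists>s\<in>S. (\<forall>f\<in>F. f x = 0 \<longrightarrow> f s = 0) \<and> (\<exists>f\<in>F. 0 < f s)"
    and x: "x \<in> M" "\<forall>f\<in>F. 0 \<le> f x" "x \<noteq> 0"
  shows "0 < w x \<and> x /\<^sub>R w x \<in> convex hull S"
  using x
proof (induction "card {f \<in> F. f x \<noteq> 0}" arbitrary: x rule: less_induct)
  case less
  obtain s where s: "s \<in> S" "\<forall>f\<in>F. f x = 0 \<longrightarrow> f s = 0" "\<exists>f\<in>F. 0 < f s"
    using descent less.prems by blast
  define P where "P = {f \<in> F. 0 < f s}"
  \<comment> \<open>Ratio test: the largest step along \<open>- s\<close> that violates no
    constraint. The minimum is attained at some \<open>g\<close>, which becomes tight.\<close>
  define \<epsilon> where "\<epsilon> = Min ((\<lambda>f. f x / f s) ` P)"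
  have P: "finite P" "P \<noteq> {}" using F s by (auto simp: P_def)
  have "\<epsilon> \<in> (\<lambda>f. f x / f s) ` P" unfolding \<epsilon>_def using P by (intro Min_in) auto
  then obtain g where g: "g \<in> F" "0 < g s" "\<epsilon> = g x / g s" by (auto simp: P_def)
  have "g x > 0" using g(1,2) s(2) less.prems(2) by (metis less_irrefl order_le_less)
  then have \<epsilon>: "\<epsilon> > 0" using g by simp
  define x' where "x' = x - \<epsilon> *\<^sub>R s"
  have f_x': "f x' = f x - \<epsilon> * f s" if "linear f" for f :: "'a \<Rightarrow> real"
    using that by (simp add: x'_def linear_diff linear_scale)
  have x'_M: "x' \<in> M"
    unfolding x'_def using M s(1) less.prems(1) by (auto intro!: subspace_diff subspace_scale)
  have x'_nonneg: "\<forall>f\<in>F. 0 \<le> f x'"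
  proof
    fix f assume f: "f \<in> F"
    show "0 \<le> f x'"
    proof (cases "0 < f s")
      case True
      then have "\<epsilon> \<le> f x / f s" unfolding \<epsilon>_def using P f by (intro Min_le) (auto simp: P_def)
      then show ?thesis using True f_x'[OF F(2)[OF f]] by (simp add: pos_le_divide_eq)
    next
      case False
      then have "\<epsilon> * f s \<le> 0" using \<epsilon> by (simp add: mult_nonneg_nonpos)
      moreover have "0 \<le> f x" using f less.prems(2) by blast
      ultimately show ?thesis using f_x'[OF F(2)[OF f]] by linarith
    qed
  qed
  have w_x: "w x = w x' + \<epsilon>" using f_x'[OF w] S[OF s(1)] by simp
  show ?case
  proof (cases "x' = 0")
    case True
    then have "x = \<epsilon> *\<^sub>R s" "w x = \<epsilon>" using w_x linear_0[OF w] by (auto simp: x'_def)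
    then show ?thesis using \<epsilon> s(1) by (simp add: hull_inc)
  next
    case False
    have "g x' = 0" using f_x'[OF F(2)[OF g(1)]] g by simp
    \<comment> \<open>Tight constraints stay tight because they vanish at \<open>s\<close>, and
      \<open>g\<close> joins them.\<close>
    then have "{f \<in> F. f x' \<noteq> 0} \<subset> {f \<in> F. f x \<noteq> 0}"
      using f_x' F(2) s(2) g(1) \<open>g x > 0\<close> by fastforce
    then have "card {f \<in> F. f x' \<noteq> 0} < card {f \<in> F. f x \<noteq> 0}"
      using F(1) by (intro psubset_card_mono) auto
    then have IH: "0 < w x'" "x' /\<^sub>R w x' \<in> convex hull S"
      using less.hyps x'_M x'_nonneg False by auto
    have "x /\<^sub>R w x = (w x' / w x) *\<^sub>R (x' /\<^sub>R w x') + (\<epsilon> / w x) *\<^sub>R s"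
      using IH(1) by (simp add: x'_def divide_inverse_commute flip: scaleR_scaleR)
        (simp add: algebra_simps)
    also have "\<dots> \<in> convex hull S"
      using IH \<epsilon> s(1) w_x
      by (intro convexD[OF convex_convex_hull]) (auto simp: hull_inc add_divide_distrib[symmetric])
    finally show ?thesis using IH(1) w_x \<epsilon> by simp
  qed
qed

text \<open>The slice is convex and contains \<open>S\<close>. Conversely, on it the scaling factor
  in \<open>polyhedral_cone_descent\<close> is 1.\<close>

lemma polyhedral_cone_slice_eq_convex_hull:
  fixes F :: "('a::real_vector \<Rightarrow> real) set" and w :: "'a \<Rightarrow> real"
  assumes F: "finite F" "\<And>f. f \<in> F \<Longrightarrow> linear f" and w: "linear w"
    and M: "subspace M" "S \<subseteq> M" and S: "\<And>s. s \<in> S \<Longrightarrow> w s = 1"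
    and nonneg: "\<And>f s. f \<in> F \<Longrightarrow> s \<in> S \<Longrightarrow> 0 \<le> f s"
    and descent: "\<And>x. x \<in> M \<Longrightarrow> \<forall>f\<in>F. 0 \<le> f x \<Longrightarrow> x \<noteq> 0 \<Longrightarrow>
      \<exists>s\<in>S. (\<forall>f\<in>F. f x = 0 \<longrightarrow> f s = 0) \<and> (\<exists>f\<in>F. 0 < f s)"
  shows "convex hull S = {x \<in> M. (\<forall>f\<in>F. 0 \<le> f x) \<and> w x = 1}" (is "_ = ?C")
proof
  have "convex ?C"
    unfolding convex_def
    using F(2) w M(1)
    by (auto simp: linear_add linear_scale subspace_add subspace_scale)
  then show "convex hull S \<subseteq> ?C"
    using M S nonneg by (intro hull_minimal) auto
  show "?C \<subseteq> convex hull S"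
  proof
    fix x assume x: "x \<in> ?C"
    then have "x \<noteq> 0" using linear_0[OF w] by auto
    then have "x /\<^sub>R w x \<in> convex hull S"
      using polyhedral_cone_descent[OF F w M S descent] x by blast
    then show "x \<in> convex hull S" using x by simp
  qed
qed

section \<open>The cone over the moment polytope\<close>

locale moment_cone = edge_cuts G side
  for G :: "'v::finite pair_pre_digraph" and side
begin

lemma e3_eq: "is_simple_trek3 G i j k T \<Longrightarrow> e3 G i j k = trek3_vec T"
  by (simp add: e3_def simple_trek3_eq)

abbreviation inflow :: "real ^ ('v \<times> 'v) \<Rightarrow> 'v \<Rightarrow> real" where
  "inflow y l \<equiv> \<Sum>h \<in> pa G l. y $ (h, l)"

abbreviation outflow :: "real ^ ('v \<times> 'v) \<Rightarrow> 'v \<Rightarrow> real" where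
  "outflow y l \<equiv> \<Sum>m \<in> ch G l. y $ (l, m)"

text \<open>The normalisation is left out, so that these functionals cut out a cone.\<close>

definition constraints :: "((real ^ 'v) \<times> (real ^ ('v \<times> 'v)) \<Rightarrow> real) set" where
  "constraints =
     (\<lambda>l x. fst x $ l) ` pverts G \<union>
     (\<lambda>a x. snd x $ a) ` parcs G \<union>
     (\<lambda>a x. 2 * fst x $ fst a + inflow (snd x) (fst a) - snd x $ a) ` parcs G \<union>
     (\<lambda>l x. 3 * fst x $ l + inflow (snd x) l - outflow (snd x) l) ` pverts G"

lemma ball_constraints:
  "(\<forall>f\<in>constraints. P f) \<longleftrightarrow>
     (\<forall>l\<in>pverts G. P (\<lambda>x. fst x $ l)) \<and>
     (\<forall>(l, m)\<in>parcs G. P (\<lambda>x. snd x $ (l, m))) \<and>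
     (\<forall>(l, m)\<in>parcs G. P (\<lambda>x. 2 * fst x $ l + inflow (snd x) l - snd x $ (l, m))) \<and>
     (\<forall>l\<in>pverts G. P (\<lambda>x. 3 * fst x $ l + inflow (snd x) l - outflow (snd x) l))"
  unfolding constraints_def by (simp add: ball_Un split_beta conj_assoc)

lemma linear_constraint: "f \<in> constraints \<Longrightarrow> linear f"
  unfolding constraints_def
  by (auto intro!: linearI simp: algebra_simps sum.distrib sum_distrib_left)

lemma subspace_moment_space: "subspace (moment_space G)"
  by (auto simp: subspace_def moment_space_def zero_prod_def)

section \<open>The inequalities for vectors of 3-treks\<close>

lemma awalk_count_verts_le:
  assumes "awalk u p v"
  shows "of_bool (l = u) + count_list (map snd p) l \<le> 1"
proof -
  have "distinct (pawalk_verts u p)" "pcas u p v"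
    using awalk_imp_apath[OF assms] by (auto simp: apath_def)
  then show ?thesis
    using count_list_pawalk_verts_snd[of u p v l] of_bool_count_distinct[of "pawalk_verts u p" l]
    by (metis of_bool_less_eq_one)
qed

text \<open>Both sides count the visits to \<open>l\<close>.\<close>

lemma awalk_count_fst:
  assumes "awalk u p v"
  shows "count_list (map fst p) l + of_bool (l = v) = of_bool (l = u) + count_list (map snd p) l"
proof -
  have "pcas u p v" using assms by auto
  then show ?thesis
    using count_list_pawalk_verts_fst[of u p v l] count_list_pawalk_verts_snd[of u p v l] by simp
qed

lemma inflow_trek3_vec:
  assumes "set p \<subseteq> parcs G" "set q \<subseteq> parcs G" "set r \<subseteq> parcs G"
  shows "inflow (snd (trek3_vec (t, p, q, r))) l =
    real (count_list (map snd p) l + count_list (map snd q) l + count_list (map snd r) l)"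
  using assms
  by (simp add: sum.distrib sum_count_list_snd[where R = "parcs G"] pa_def flip: of_nat_sum)

lemma outflow_trek3_vec:
  assumes "set p \<subseteq> parcs G" "set q \<subseteq> parcs G" "set r \<subseteq> parcs G"
  shows "outflow (snd (trek3_vec (t, p, q, r))) l =
    real (count_list (map fst p) l + count_list (map fst q) l + count_list (map fst r) l)"
  using assms
  by (simp add: sum.distrib sum_count_list_fst[where R = "parcs G"] ch_def flip: of_nat_sum)

text \<open>Conservation of flow summed over the three paths, whose starts at the top account for
  the coefficient 3. The slack of the last inequality is thus the number of paths ending at
  \<open>l\<close>.\<close>

lemma trek3_balance:
  assumes w: "awalk t p i" "awalk t q j" "awalk t r k"
  shows "3 * fst (trek3_vec (t, p, q, r)) $ l + inflow (snd (trek3_vec (t, p, q, r))) l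
    - outflow (snd (trek3_vec (t, p, q, r))) l = of_bool (l = i) + of_bool (l = j) + of_bool (l = k)"
proof -
  have sub: "set p \<subseteq> parcs G" "set q \<subseteq> parcs G" "set r \<subseteq> parcs G"
    using w by auto
  have eq: "real (count_list (map fst p) l) + of_bool (l = i) = of_bool (l = t) + real (count_list (map snd p) l)"
    "real (count_list (map fst q) l) + of_bool (l = j) = of_bool (l = t) + real (count_list (map snd q) l)"
    "real (count_list (map fst r) l) + of_bool (l = k) = of_bool (l = t) + real (count_list (map snd r) l)"
    using awalk_count_fst[OF w(1), of l] awalk_count_fst[OF w(2), of l] awalk_count_fst[OF w(3), of l]
    by (metis of_nat_add of_nat_of_bool)+
  have "fst (trek3_vec (t, p, q, r)) $ l = of_bool (l = t)" by simp
  then show ?thesis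
    unfolding inflow_trek3_vec[OF sub] outflow_trek3_vec[OF sub] using eq by simp
qed

lemma trek3_arc_slack:
  assumes w: "awalk t p i" "awalk t q j" "awalk t r k"
  shows "2 * fst (trek3_vec (t, p, q, r)) $ l + inflow (snd (trek3_vec (t, p, q, r))) l
    - snd (trek3_vec (t, p, q, r)) $ (l, m) =
    2 * of_bool (l = t) + real (count_list (map snd p) l + count_list (map snd q) l + count_list (map snd r) l)
    - real (count_list p (l, m) + count_list q (l, m) + count_list r (l, m))"
proof -
  have sub: "set p \<subseteq> parcs G" "set q \<subseteq> parcs G" "set r \<subseteq> parcs G"
    using w by auto
  show ?thesis
    unfolding inflow_trek3_vec[OF sub] by simp
qed

lemma awalk_count_arc_le:
  assumes "awalk u p v"
  shows "count_list p (l, m) \<le> of_bool (l = u) + count_list (map snd p) l"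
  using awalk_count_fst[OF assms, of l] count_list_pair_le_fst[of p l m] by linarith

text \<open>Away from the top, each use of an edge is preceded by an entry into its tail. At the
  top, simplicity prevents all three paths from sharing an edge, which explains the coefficient
  2.\<close>

lemma simple_trek3_nonneg:
  assumes T: "is_simple_trek3 G i j k T"
  shows "\<forall>f\<in>constraints. 0 \<le> f (trek3_vec T)"
proof -
  obtain t p q r where T_eq: "T = (t, p, q, r)" by (cases T rule: prod_cases4)
  have w: "awalk t p i" "awalk t q j" "awalk t r k"
    using T by (auto simp: T_eq apath_def)
  note le = awalk_count_arc_le[OF w(1)] awalk_count_arc_le[OF w(2)] awalk_count_arc_le[OF w(3)]
  have arc: "0 \<le> 2 * fst (trek3_vec T) $ l + inflow (snd (trek3_vec T)) l - snd (trek3_vec T) $ (l, m)"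
    if lm: "(l, m) \<in> parcs G" for l m
  proof (cases "l = t")
    case False
    then have "count_list p (l, m) + count_list q (l, m) + count_list r (l, m)
        \<le> count_list (map snd p) l + count_list (map snd q) l + count_list (map snd r) l"
      using le[of l m] by simp
    from of_nat_mono[OF this, where 'a = real] show ?thesis
      unfolding T_eq trek3_arc_slack[OF w] using False by simp
  next
    case True
    have "\<not> ((l, m) \<in> set p \<and> (l, m) \<in> set q \<and> (l, m) \<in> set r)"
    proof
      assume "(l, m) \<in> set p \<and> (l, m) \<in> set q \<and> (l, m) \<in> set r"
      then have "m \<in> set (pawalk_verts t p) \<inter> set (pawalk_verts t q) \<inter> set (pawalk_verts t r)"
        using w unfolding awalk_def by (auto intro: snd_in_pawalk_verts)
      then have "m = t" using T by (auto simp: T_eq)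
      then show False using True fst_notin_side[OF lm] snd_in_side[OF lm] by simp
    qed
    then have "count_list p (l, m) = 0 \<or> count_list q (l, m) = 0 \<or> count_list r (l, m) = 0"
      by (auto simp: count_list_0_iff)
    then have "count_list p (l, m) + count_list q (l, m) + count_list r (l, m)
        \<le> 2 + (count_list (map snd p) l + count_list (map snd q) l + count_list (map snd r) l)"
      using le[of l m] True by auto
    from of_nat_mono[OF this, where 'a = real] show ?thesis
      unfolding T_eq trek3_arc_slack[OF w] using True by simp
  qed
  have bal: "0 \<le> 3 * fst (trek3_vec T) $ l + inflow (snd (trek3_vec T)) l - outflow (snd (trek3_vec T)) l" for l
    unfolding T_eq trek3_balance[OF w] by simp
  show ?thesis
    unfolding ball_constraints using arc bal by (auto simp: T_eq)
qed

lemma trek3_vec_in_moment_space: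
  assumes "is_trek3 G i j k T"
  shows "trek3_vec T \<in> moment_space G"
proof -
  obtain t p q r where T_eq: "T = (t, p, q, r)" by (cases T rule: prod_cases4)
  have "awalk t p i" "awalk t q j" "awalk t r k"
    using assms by (auto simp: T_eq apath_def)
  then have "t \<in> pverts G" "set p \<subseteq> parcs G" "set q \<subseteq> parcs G" "set r \<subseteq> parcs G"
    by auto
  moreover have "count_list xs a = 0" if "set xs \<subseteq> parcs G" "a \<notin> parcs G" for xs a
    using that by (auto simp: count_list_0_iff)
  ultimately show ?thesis
    by (auto simp: T_eq moment_space_def)
qed

lemma sum_fst_trek3_vec:
  assumes "is_trek3 G i j k T"
  shows "(\<Sum>l\<in>pverts G. fst (trek3_vec T) $ l) = 1"
proof -
  obtain t p q r where T_eq: "T = (t, p, q, r)" by (cases T rule: prod_cases4)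
  have "t \<in> pverts G"
    using assms by (auto simp: T_eq apath_def)
  then show ?thesis by (simp add: T_eq sum.delta)
qed

section \<open>A 3-trek adapted to the tight inequalities\<close>

text \<open>Without mass at the vertices, no edge carries more than the inflow at its tail, so
  \<open>y\<close> vanishes by induction on the height.\<close>

lemma mass_positive:
  assumes x: "(z, y) \<in> moment_space G" "\<forall>f\<in>constraints. 0 \<le> f (z, y)" "(z, y) \<noteq> 0"
  obtains t where "t \<in> pverts G" "0 < z $ t"
proof -
  have "\<exists>t\<in>pverts G. 0 < z $ t"
  proof (rule ccontr)
    assume "\<not> ?thesis"
    then have z: "z $ l = 0" for l
      using x(1,2) by (cases "l \<in> pverts G") (force simp: ball_constraints moment_space_def)+
    have "y $ (l, m) = 0" if "(l, m) \<in> parcs G" for l m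
      using that
    proof (induction "height l" arbitrary: l m rule: less_induct)
      case less
      have "inflow y l = 0"
        using less.hyps height_less by (intro sum.neutral) (auto simp: pa_def)
      then have "y $ (l, m) \<le> 0" "0 \<le> y $ (l, m)"
        using x(2) less.prems z by (force simp: ball_constraints)+
      then show ?case by simp
    qed
    then have "y $ a = 0" for a
      using x(1) by (cases a; cases "a \<in> parcs G") (auto simp: moment_space_def)
    then show False using z x(3) by (simp add: zero_prod_def vec_eq_iff)
  qed
  then show ?thesis using that by blast
qed

text \<open>All vertices after the edge lie beyond its cut, and a walk from \<open>t\<close> gets
  there only through that edge.\<close>

lemma paths_disjoint_after_arc:
  assumes p: "awalk t ((t, m) # p) i" and q: "awalk t q k" "(t, m) \<notin> set q"
  shows "set (pawalk_verts t ((t, m) # p)) \<inter> set (pawalk_verts t q) = {t}"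
proof -
  have tm: "(t, m) \<in> parcs G" "awalk m p i" using p by (auto simp: awalk_Cons_iff)
  have "x \<notin> set (pawalk_verts t q)" if x: "x \<in> set (pawalk_verts m p)" for x
  proof
    assume "x \<in> set (pawalk_verts t q)"
    then obtain q1 q2 where q1: "q = q1 @ q2" "awalk t q1 x"
      using awalk_decomp[OF q(1)] by blast
    obtain p1 where "awalk m p1 x"
      using awalk_decomp[OF tm(2) x] by blast
    then have "x \<in> side (t, m)"
      using awalk_side_mono tm(1) snd_in_side[OF tm(1)] by auto
    then have "(t, m) \<in> set q1"
      using in_set_awalk[OF q1(2) tm(1)] fst_notin_side[OF tm(1)] by simp
    then show False using q1 q(2) by simp
  qed
  moreover have "t \<in> set (pawalk_verts t q)" using q(1) hd_in_awalk_verts by auto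
  ultimately show ?thesis by auto
qed

text \<open>
  From the top \<open>t\<close> two paths leave together, along the tight arc if there is one, and the third
  path leaves along another arc if the mass at \<open>t\<close> is exhausted. At any other vertex all
  paths continue in the same way.
\<close>

lemma tight_trek3_exists:
  assumes nonneg: "\<forall>f\<in>constraints. 0 \<le> f (z, y)" and t: "t \<in> pverts G" "0 < z $ t"
  obtains i k p q where "is_simple_trek3 G i i k (t, p, p, q)"
    "\<forall>f\<in>constraints. f (z, y) = 0 \<longrightarrow> f (trek3_vec (t, p, p, q)) = 0"
proof -
  have z: "0 \<le> z $ l" if "l \<in> pverts G" for l
    using nonneg that by (simp add: ball_constraints)
  have y: "0 \<le> y $ (l, m)" if "(l, m) \<in> parcs G" for l m
    using nonneg that by (auto simp: ball_constraints)
  have arc: "y $ (l, m) \<le> 2 * z $ l + inflow y l" if "(l, m) \<in> parcs G" for l m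
    using nonneg that by (auto simp: ball_constraints)
  have out: "outflow y l \<le> 3 * z $ l + inflow y l" if "l \<in> pverts G" for l
    using nonneg that by (simp add: ball_constraints)
  have inflow_nonneg: "0 \<le> inflow y l" for l
    using y by (intro sum_nonneg) (auto simp: pa_def)
  have inflow_pos: "0 < inflow y m" if "(l, m) \<in> parcs G" "0 < y $ (l, m)" for l m
    using that y by (intro sum_pos2[of _ l]) (auto simp: pa_def)
  define tight where "tight l m \<longleftrightarrow> (l, m) \<in> parcs G \<and> y $ (l, m) = 2 * z $ l + inflow y l" for l m
  define full where "full l \<longleftrightarrow> outflow y l = 3 * z $ l + inflow y l" for l
  define active where "active l \<longleftrightarrow> l \<in> pverts G \<and> 0 < z $ l + inflow y l" for l
  \<comment> \<open>\<open>None\<close> stands for stopping. Each clause protects one family of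
    constraints: positive weights keep zero coordinates of \<open>y\<close> at zero, tight edges are
    followed, and by \<open>trek3_balance\<close> no path may end at a full vertex.\<close>
  define good where "good l b \<longleftrightarrow> (\<forall>m. b = Some m \<longrightarrow> (l, m) \<in> parcs G \<and> 0 < y $ (l, m)) \<and>
      (\<forall>m. tight l m \<longrightarrow> b = Some m) \<and> (full l \<longrightarrow> b \<noteq> None)" for l b
  have good_exists: "\<exists>b. good l b" if l: "active l" for l
  proof (cases "\<exists>m. tight l m")
    case True
    then obtain m where m: "tight l m" by blast
    have "m' = m" if m': "tight l m'" for m'
    proof (rule ccontr)
      assume "m' \<noteq> m"
      \<comment> \<open>Two tight edges would carry \<open>4 * z $ l + 2 * inflow y l\<close>
        together, more than the outflow bound allows at an active vertex.\<close>
      then have "y $ (l, m) + y $ (l, m') = (\<Sum>m\<in>{m, m'}. y $ (l, m))" by simp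
      also have "\<dots> \<le> outflow y l"
        using m m' y by (intro sum_mono2) (auto simp: tight_def ch_def)
      finally show False
        using m m' out[of l] l by (auto simp: tight_def active_def)
    qed
    moreover have "(l, m) \<in> parcs G" "0 < y $ (l, m)"
      using m l z[of l] inflow_nonneg[of l] by (auto simp: tight_def active_def)
    ultimately have "good l (Some m)" unfolding good_def by blast
    then show ?thesis by blast
  next
    case False
    show ?thesis
    proof (cases "full l")
      case True
      have "0 < outflow y l"
        using True l z[of l] inflow_nonneg[of l] by (auto simp: full_def active_def)
      then obtain m where "m \<in> ch G l" "0 < y $ (l, m)"
        by (meson not_le sum_nonpos)
      then show ?thesis
        using False by (intro exI[of _ "Some m"]) (auto simp: good_def ch_def)
    next
      case not_full: False
      then show ?thesis using False by (intro exI[of _ None]) (auto simp: good_def)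
    qed
  qed
  define nx where "nx l = (if active l then SOME b. good l b else None)" for l
  have nx_good: "good l (nx l)" if "active l" for l
    using someI_ex[OF good_exists[OF that]] that by (simp add: nx_def)
  have nx_Some: "(l, m) \<in> parcs G \<and> 0 < y $ (l, m)" if "nx l = Some m" for l m
  proof -
    have "active l" using that by (auto simp: nx_def split: if_splits)
    then show ?thesis using nx_good[of l] that by (simp add: good_def)
  qed
  have active_snd: "active m" if "(l, m) \<in> parcs G" "0 < y $ (l, m)" for l m
    using that inflow_pos[OF that] z[of m] in_arcsD2 by (force simp: active_def)
  have active_t: "active t" using t inflow_nonneg[of t] by (simp add: active_def)

  \<comment> \<open>The choice \<open>nx\<close> is not imposed at \<open>t\<close>, where the third
    path may have to leave differently from the other two or stop at once.\<close>
  define ok where "ok p v \<longleftrightarrow> awalk t p v \<and>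
      (\<forall>(a, b)\<in>set p. 0 < y $ (a, b) \<and> (a \<noteq> t \<longrightarrow> nx a = Some b)) \<and>
      (v \<noteq> t \<longrightarrow> nx v = None) \<and> \<not> full v" for p v
  have ok_extend: "\<exists>p v. ok ((t, m) # p) v \<and> t \<notin> fst ` set p"
    if tm: "(t, m) \<in> parcs G" "0 < y $ (t, m)" for m
  proof -
    obtain p v where p: "awalk m p v" "\<And>a b. (a, b) \<in> set p \<Longrightarrow> nx a = Some b" "nx v = None"
      using follow_successors[of nx m] nx_Some in_arcsD2[OF tm(1)] by blast
    have tmp: "awalk t ((t, m) # p) v" using p(1) tm by (simp add: awalk_Cons_iff)
    \<comment> \<open>\<open>None\<close> is also the default of \<open>nx\<close> at inactive
      vertices; only at an active one does it show that stopping is allowed.\<close>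
    have "active v"
    proof (cases "v = m")
      case True
      then show ?thesis using active_snd tm by simp
    next
      case False
      have "v \<in> snd ` set p"
        using p(1) False set_pawalk_verts_snd[of m p v] set_pawalk_verts_fst[of m p v] by auto
      then show ?thesis using p(2) nx_Some active_snd by fastforce
    qed
    then have "\<not> full v" using nx_good[of v] p(3) by (auto simp: good_def)
    moreover have "t \<notin> fst ` set p"
      using awalk_imp_apath[OF tmp] fst_in_pawalk_verts[of t _ p m] by (auto simp: apath_Cons_iff)
    moreover have "\<forall>(a, b)\<in>set ((t, m) # p). 0 < y $ (a, b) \<and> (a \<noteq> t \<longrightarrow> nx a = Some b)"
      using p(2) nx_Some tm(2) by fastforce
    ultimately show ?thesis
      using tmp p(3) unfolding ok_def by blast
  qed

  obtain p i q k where p: "ok p i" and q: "ok q k"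
    and disjoint: "set (pawalk_verts t p) \<inter> set (pawalk_verts t q) = {t}"
    and tight_p: "\<And>m. tight t m \<Longrightarrow> (t, m) \<in> set p"
  proof (cases "nx t")
    case None
    then have "\<not> full t" "\<And>m. \<not> tight t m" using nx_good[OF active_t] by (auto simp: good_def)
    then show ?thesis using t that[of "[]" t "[]" t] by (simp add: ok_def awalk_Nil_iff)
  next
    case (Some m)
    have tm: "(t, m) \<in> parcs G" "0 < y $ (t, m)" using nx_Some[OF Some] by auto
    obtain p i where p: "ok ((t, m) # p) i" using ok_extend[OF tm] by blast
    have "\<exists>q k. ok q k \<and> (t, m) \<notin> set q"
    proof (cases "full t")
      case False
      then show ?thesis
        using t by (intro exI[of _ "[]"] exI[of _ t]) (simp add: ok_def awalk_Nil_iff)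
    next
      case True
      \<comment> \<open>A full \<open>t\<close> sends out \<open>3 * z $ t + inflow y t\<close>, of
        which \<open>(t, m)\<close> takes at most \<open>2 * z $ t + inflow y t\<close>. At least
        \<open>z $ t\<close> remains for another edge.\<close>
      have "outflow y t = y $ (t, m) + (\<Sum>m\<in>ch G t - {m}. y $ (t, m))"
        using tm by (intro sum.remove) (auto simp: ch_def)
      then have "0 < (\<Sum>m\<in>ch G t - {m}. y $ (t, m))"
        using True arc[OF tm(1)] t(2) by (simp add: full_def)
      then obtain m' where m': "m' \<in> ch G t - {m}" "0 < y $ (t, m')"
        by (meson not_le sum_nonpos)
      then obtain q k where "ok ((t, m') # q) k" "t \<notin> fst ` set q"
        using ok_extend[of m'] by (auto simp: ch_def)
      moreover from this have "(t, m) \<notin> set ((t, m') # q)" using m'(1) by force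
      ultimately show ?thesis by blast
    qed
    then obtain q k where q: "ok q k" "(t, m) \<notin> set q" by blast
    have "set (pawalk_verts t ((t, m) # p)) \<inter> set (pawalk_verts t q) = {t}"
      using paths_disjoint_after_arc[of t m p i q k] p q unfolding ok_def by blast
    moreover have "(t, m') \<in> set ((t, m) # p)" if "tight t m'" for m'
      using that nx_good[OF active_t] Some by (simp add: good_def)
    ultimately show ?thesis using that p q(1) by blast
  qed

  have w: "awalk t p i" "awalk t p i" "awalk t q k" using p q by (auto simp: ok_def)
  have simple: "is_simple_trek3 G i i k (t, p, p, q)"
    using w disjoint by (simp add: awalk_imp_apath)
  \<comment> \<open>A path entering \<open>l\<close> cannot stop there and must continue along the
    tight edge, which \<open>nx\<close> selects.\<close>
  have follows_tight: "count_list (map snd r) l \<le> count_list r (l, m)"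
    if r: "ok r v" and l: "l \<noteq> t" "tight l m" for r v l m
  proof (cases "l \<in> snd ` set r")
    case True
    have wr: "awalk t r v" using r by (simp add: ok_def)
    obtain h where h: "(h, l) \<in> set r" using True by auto
    then have "active l" using r wr active_snd by (fastforce simp: ok_def)
    then have nx_l: "nx l = Some m" using nx_good[of l] l by (simp add: good_def)
    then have "l \<noteq> v" using r l(1) by (auto simp: ok_def)
    moreover have "l \<in> insert v (fst ` set r)"
      using True wr set_pawalk_verts_snd[of t r v] set_pawalk_verts_fst[of t r v] by auto
    ultimately obtain b where b: "(l, b) \<in> set r" by auto
    then have "nx l = Some b" using r l(1) by (auto simp: ok_def)
    then have "count_list r (l, m) \<noteq> 0" using b nx_l by (simp add: count_list_0_iff)
    then show ?thesis using awalk_count_verts_le[OF wr, of l] by linarith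
  qed (simp add: count_list_0_iff)
  have tight_zero: "2 * fst (trek3_vec (t, p, p, q)) $ l + inflow (snd (trek3_vec (t, p, p, q))) l
      - snd (trek3_vec (t, p, p, q)) $ (l, m) \<le> 0" if lm: "tight l m" for l m
  proof (cases "l = t")
    case True
    \<comment> \<open>The two copies of \<open>p\<close> use up the allowance 2 at the top.\<close>
    have "count_list p (t, m) \<noteq> 0" using tight_p lm True by (simp add: count_list_0_iff)
    then show ?thesis
      unfolding trek3_arc_slack[OF w]
      using True awalk_count_verts_le[OF w(1), of t] awalk_count_verts_le[OF w(3), of t] by simp
  next
    case False
    then show ?thesis
      unfolding trek3_arc_slack[OF w]
      using follows_tight[OF p False lm] follows_tight[OF q False lm] by simp
  qed
  have full_zero: "3 * fst (trek3_vec (t, p, p, q)) $ l + inflow (snd (trek3_vec (t, p, p, q))) l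
      - outflow (snd (trek3_vec (t, p, p, q))) l = 0" if "full l" for l
    unfolding trek3_balance[OF w] using that p q by (auto simp: ok_def)
  have nonneg_T: "0 \<le> 2 * fst (trek3_vec (t, p, p, q)) $ l + inflow (snd (trek3_vec (t, p, p, q))) l
      - snd (trek3_vec (t, p, p, q)) $ (l, m)" if "(l, m) \<in> parcs G" for l m
    using simple_trek3_nonneg[OF simple] that unfolding ball_constraints by blast
  have "\<forall>f\<in>constraints. f (z, y) = 0 \<longrightarrow> f (trek3_vec (t, p, p, q)) = 0"
    unfolding ball_constraints
  proof (intro conjI)
    show "\<forall>l\<in>pverts G. fst (z, y) $ l = 0 \<longrightarrow> fst (trek3_vec (t, p, p, q)) $ l = 0"
      using t(2) by auto
    have "(l, m) \<notin> set p \<and> (l, m) \<notin> set q" if "y $ (l, m) = 0" for l m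
      using p q that unfolding ok_def by (metis (no_types, lifting) case_prodD less_irrefl)
    then show "\<forall>(l, m)\<in>parcs G. snd (z, y) $ (l, m) = 0 \<longrightarrow> snd (trek3_vec (t, p, p, q)) $ (l, m) = 0"
      by (simp add: count_notin)
    show "\<forall>(l, m)\<in>parcs G. 2 * fst (z, y) $ l + inflow (snd (z, y)) l - snd (z, y) $ (l, m) = 0 \<longrightarrow>
        2 * fst (trek3_vec (t, p, p, q)) $ l + inflow (snd (trek3_vec (t, p, p, q))) l
        - snd (trek3_vec (t, p, p, q)) $ (l, m) = 0"
    proof clarify
      fix l m assume lm: "(l, m) \<in> parcs G"
        "2 * fst (z, y) $ l + inflow (snd (z, y)) l - snd (z, y) $ (l, m) = 0"
      then have "tight l m" by (simp add: tight_def)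
      then show "2 * fst (trek3_vec (t, p, p, q)) $ l + inflow (snd (trek3_vec (t, p, p, q))) l
        - snd (trek3_vec (t, p, p, q)) $ (l, m) = 0"
        using tight_zero nonneg_T[OF lm(1)] by (meson order_antisym)
    qed
    show "\<forall>l\<in>pverts G. 3 * fst (z, y) $ l + inflow (snd (z, y)) l - outflow (snd (z, y)) l = 0 \<longrightarrow>
        3 * fst (trek3_vec (t, p, p, q)) $ l + inflow (snd (trek3_vec (t, p, p, q))) l
        - outflow (snd (trek3_vec (t, p, p, q))) l = 0"
      using full_zero by (simp add: full_def)
  qed
  then show ?thesis using that simple by blast
qed

section \<open>The polytope as a slice of the cone\<close>

lemma moment_polytope3_eq:
  "moment_polytope3 G =
    {x \<in> moment_space G. (\<forall>f\<in>constraints. 0 \<le> f x) \<and> (\<Sum>l\<in>pverts G. fst x $ l) = 1}"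
proof -
  define S where "S = {e3 G i j k | i j k.
        i \<in> pverts G \<and> j \<in> pverts G \<and> k \<in> pverts G \<and> (\<exists>T. is_trek3 G i j k T)}"
  have S_trek: "\<exists>i j k T. s = trek3_vec T \<and> is_simple_trek3 G i j k T" if "s \<in> S" for s
    using that unfolding S_def by (blast elim: simple_trek3_exists intro: e3_eq)
  have trek: "is_trek3 G i j k T" if "is_simple_trek3 G i j k T" for i j k T
    using that by (cases T rule: prod_cases4) simp
  have trek_S: "trek3_vec T \<in> S" if T: "is_simple_trek3 G i j k T" for i j k T
  proof -
    have "i \<in> pverts G" "j \<in> pverts G" "k \<in> pverts G"
      using trek[OF T] by (cases T rule: prod_cases4; auto simp: apath_def)+
    then show ?thesis
      using e3_eq[OF T] trek[OF T] unfolding S_def mem_Collect_eq by metis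
  qed
  have "convex hull S =
      {x \<in> moment_space G. (\<forall>f\<in>constraints. 0 \<le> f x) \<and> (\<Sum>l\<in>pverts G. fst x $ l) = 1}"
  proof (rule polyhedral_cone_slice_eq_convex_hull)
    show "finite constraints" by (simp add: constraints_def)
    show "linear (\<lambda>x::(real ^ 'v) \<times> (real ^ ('v \<times> 'v)). \<Sum>l\<in>pverts G. fst x $ l)"
      by (auto intro!: linearI simp: sum.distrib sum_distrib_left)
    show "subspace (moment_space G)" by (rule subspace_moment_space)
    show "S \<subseteq> moment_space G" using S_trek trek trek3_vec_in_moment_space by blast
    show "(\<Sum>l\<in>pverts G. fst s $ l) = 1" if "s \<in> S" for s
      using S_trek[OF that] trek sum_fst_trek3_vec by blast
    show "0 \<le> f s" if "f \<in> constraints" "s \<in> S" for f s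
      using S_trek[OF that(2)] simple_trek3_nonneg that(1) by blast
    show "\<exists>s\<in>S. (\<forall>f\<in>constraints. f x = 0 \<longrightarrow> f s = 0) \<and> (\<exists>f\<in>constraints. 0 < f s)"
      if x: "x \<in> moment_space G" "\<forall>f\<in>constraints. 0 \<le> f x" "x \<noteq> 0" for x
    proof -
      obtain z y where x_eq: "x = (z, y)" by (cases x)
      obtain t where t: "t \<in> pverts G" "0 < z $ t" using mass_positive x unfolding x_eq by blast
      obtain i k p q where T: "is_simple_trek3 G i i k (t, p, p, q)"
        "\<forall>f\<in>constraints. f x = 0 \<longrightarrow> f (trek3_vec (t, p, p, q)) = 0"
        using tight_trek3_exists[OF x(2)[unfolded x_eq] t] unfolding x_eq by blast
      \<comment> \<open>The coordinate of the top equals 1 on the trek vector, which supplies the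
        positive constraint that bounds the descent step.\<close>
      have "(\<lambda>x. fst x $ t) \<in> constraints" using t(1) by (auto simp: constraints_def)
      then have "\<exists>f\<in>constraints. 0 < f (trek3_vec (t, p, p, q))" by (rule rev_bexI) simp
      then show ?thesis using T trek_S by blast
    qed
  qed (rule linear_constraint)
  then show ?thesis unfolding moment_polytope3_def S_def by simp
qed

end

theorem theorem6p3:
  fixes G :: "'v::finite pair_pre_digraph"
  assumes "polytree G"
  shows "moment_polytope3 G =
    {(z, y). (z, y) \<in> moment_space G \<and>
       (\<forall>l \<in> pverts G. z $ l \<ge> 0) \<and>
       (\<forall>(l, m) \<in> parcs G. y $ (l, m) \<ge> 0) \<and>
       (\<Sum>l \<in> pverts G. z $ l) = 1 \<and>
       (\<forall>(l, m) \<in> parcs G. 2 * z $ l + (\<Sum>h \<in> pa G l. y $ (h, l)) - y $ (l, m) \<ge> 0) \<and>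
       (\<forall>l \<in> pverts G. 3 * z $ l + (\<Sum>h \<in> pa G l. y $ (h, l)) - (\<Sum>m \<in> ch G l. y $ (l, m)) \<ge> 0)}"
proof -
  interpret moment_cone G "edge_side G"
    using polytree_edge_cuts[OF assms] by (simp add: moment_cone_def)
  show ?thesis
    unfolding moment_polytope3_eq ball_constraints by auto
qed

end
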